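(* Let $(M,g)$ be a smooth Riemannian manifold and let $N$ be the Nash dimension of $M$. Then there exists an isometric embedding $u:(M,g)\to\mathbb{R}^{2N}$ whose image $u(M)$ is a bounded subset of $\mathbb{R}^{2N}$.
   Context: Everything is $C^\infty$-smooth. Euclidean spaces carry their standard flat metrics. An isometric embedding $u:(M,g)\to\mathbb{R}^D$ is a smooth embedding such that the pullback of the Euclidean metric under $u$ equals $g$. The Nash dimension $N(M)$ of a smooth manifold $M$ is the smallest integer $N$ such that, for every Riemannian metric $h$ on $M$, the Riemannian manifold $(M,h)$ can be isometrically embedded into $\mathbb{R}^N$. *)

theory Defs
  imports "HOL-Analysis.Analysis"
begin

text \<open>
  Euclidean $n$-space is the library's \<^term>\<open>Euclidean_space n\<close>, whose points are the functions
  of type \<^typ>\<open>nat \<Rightarrow> real\<close> that vanish at all indices \<open>i \<ge> n\<close>. The dimension is thus an ordinary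
  natural number, possibly \<open>0\<close>, and can be quantified over. The topology is the Euclidean one;
  the metric of the type \<^typ>\<open>nat \<Rightarrow> real\<close> (under which everything is bounded) is never used.
\<close>

definition partial :: "nat \<Rightarrow> ((nat \<Rightarrow> real) \<Rightarrow> real) \<Rightarrow> (nat \<Rightarrow> real) \<Rightarrow> real" where
  "partial i f x = deriv (\<lambda>t. f (x(i := t))) (x i)"

text \<open>
  \<open>S\<close> is meant to be open in \<^term>\<open>Euclidean_space n\<close>; then only the values of \<open>f\<close> on \<open>S\<close> matter.
\<close>

fun Ck_on :: "nat \<Rightarrow> nat \<Rightarrow> (nat \<Rightarrow> real) set \<Rightarrow> ((nat \<Rightarrow> real) \<Rightarrow> real) \<Rightarrow> bool" where
  "Ck_on n 0 S f \<longleftrightarrow> continuous_map (subtopology (Euclidean_space n) S) euclideanreal f"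
| "Ck_on n (Suc k) S f \<longleftrightarrow>
     continuous_map (subtopology (Euclidean_space n) S) euclideanreal f \<and>
     (\<forall>i<n. (\<forall>x\<in>S. (\<lambda>t. f (x(i := t))) field_differentiable at (x i)) \<and>
            Ck_on n k S (partial i f))"

definition smooth_on :: "nat \<Rightarrow> (nat \<Rightarrow> real) set \<Rightarrow> ((nat \<Rightarrow> real) \<Rightarrow> real) \<Rightarrow> bool" where
  "smooth_on n S f \<longleftrightarrow> (\<forall>k. Ck_on n k S f)"

definition second_countable_space :: "'a topology \<Rightarrow> bool" where
  "second_countable_space X \<longleftrightarrow>
     (\<exists>\<B>. countable \<B> \<and> (\<forall>V\<in>\<B>. openin X V) \<and>
          (\<forall>U x. openin X U \<and> x \<in> U \<longrightarrow> (\<exists>V\<in>\<B>. x \<in> V \<and> V \<subseteq> U)))"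

text \<open>
  A chart is a pair \<open>(U, \<phi>)\<close>; the values of \<open>\<phi>\<close> outside \<open>U\<close> are irrelevant, and its inverse is
  \<^term>\<open>inv_into U \<phi>\<close>. The smooth structure is given by an arbitrary, not necessarily maximal,
  atlas.
\<close>

type_synonym 'a chart = "'a set \<times> ('a \<Rightarrow> nat \<Rightarrow> real)"

definition chart_on :: "'a topology \<Rightarrow> nat \<Rightarrow> 'a chart \<Rightarrow> bool" where
  "chart_on X n = (\<lambda>(U, \<phi>). openin X U \<and> openin (Euclidean_space n) (\<phi> ` U) \<and>
     homeomorphic_map (subtopology X U) (subtopology (Euclidean_space n) (\<phi> ` U)) \<phi>)"

definition smooth_manifold :: "'a topology \<Rightarrow> nat \<Rightarrow> 'a chart set \<Rightarrow> bool" where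
  "smooth_manifold X n A \<longleftrightarrow>
     Hausdorff_space X \<and> second_countable_space X \<and>
     (\<forall>c\<in>A. chart_on X n c) \<and> \<Union> (fst ` A) = topspace X \<and>
     (\<forall>(U, \<phi>)\<in>A. \<forall>(V, \<psi>)\<in>A. \<forall>i<n. smooth_on n (\<phi> ` (U \<inter> V)) (\<lambda>y. \<psi> (inv_into U \<phi> y) i))"

definition smooth_fun :: "nat \<Rightarrow> 'a chart set \<Rightarrow> ('a \<Rightarrow> real) \<Rightarrow> bool" where
  "smooth_fun n A f \<longleftrightarrow> (\<forall>(U, \<phi>)\<in>A. smooth_on n (\<phi> ` U) (\<lambda>y. f (inv_into U \<phi> y)))"

text \<open>
  Tangent vectors at \<open>p\<close> are the derivations at \<open>p\<close> of the algebra of smooth functions on the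
  manifold. Functions on the manifold are represented by functions on the whole type \<open>'a\<close>. The
  second and third conditions say that a derivation depends only on the values of its argument on
  the manifold and is \<open>0\<close> (a mere convention) at functions that are not smooth, so that equality
  of tangent vectors is equality in HOL.
\<close>

type_synonym 'a tangent = "('a \<Rightarrow> real) \<Rightarrow> real"

definition tangent_space :: "'a topology \<Rightarrow> nat \<Rightarrow> 'a chart set \<Rightarrow> 'a \<Rightarrow> 'a tangent set" where
  "tangent_space X n A p = {v.
     (\<forall>f h. smooth_fun n A f \<and> smooth_fun n A h \<longrightarrow>
        v (\<lambda>x. f x + h x) = v f + v h \<and>
        (\<forall>c. v (\<lambda>x. c * f x) = c * v f) \<and>
        v (\<lambda>x. f x * h x) = f p * v h + h p * v f) \<and>
     (\<forall>f h. (\<forall>x\<in>topspace X. f x = h x) \<longrightarrow> v f = v h) \<and>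
     (\<forall>f. \<not> smooth_fun n A f \<longrightarrow> v f = 0)}"

definition coord_vector :: "nat \<Rightarrow> 'a chart set \<Rightarrow> 'a chart \<Rightarrow> nat \<Rightarrow> 'a \<Rightarrow> 'a tangent" where
  "coord_vector n A = (\<lambda>(U, \<phi>) i p f.
     if smooth_fun n A f then partial i (\<lambda>y. f (inv_into U \<phi> y)) (\<phi> p) else 0)"

definition riemannian_metric ::
    "'a topology \<Rightarrow> nat \<Rightarrow> 'a chart set \<Rightarrow> ('a \<Rightarrow> 'a tangent \<Rightarrow> 'a tangent \<Rightarrow> real) \<Rightarrow> bool" where
  "riemannian_metric X n A g \<longleftrightarrow>
     (\<forall>p\<in>topspace X.
        \<forall>v\<in>tangent_space X n A p. \<forall>w\<in>tangent_space X n A p. \<forall>z\<in>tangent_space X n A p.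
          g p v w = g p w v \<and>
          g p (\<lambda>f. v f + w f) z = g p v z + g p w z \<and>
          (\<forall>c. g p (\<lambda>f. c * v f) w = c * g p v w) \<and>
          (v \<noteq> (\<lambda>f. 0) \<longrightarrow> g p v v > 0)) \<and>
     (\<forall>(U, \<phi>)\<in>A. \<forall>i<n. \<forall>j<n.
        smooth_on n (\<phi> ` U) (\<lambda>y. let p = inv_into U \<phi> y in
          g p (coord_vector n A (U, \<phi>) i p) (coord_vector n A (U, \<phi>) j p)))"

text \<open>
  The differential of a map \<open>u\<close> into \<^term>\<open>Euclidean_space D\<close>, with the tangent spaces of the
  latter identified with \<^term>\<open>Euclidean_space D\<close> itself.
\<close>

definition differential :: "nat \<Rightarrow> ('a \<Rightarrow> nat \<Rightarrow> real) \<Rightarrow> 'a tangent \<Rightarrow> nat \<Rightarrow> real" where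
  "differential D u v = (\<lambda>i. if i < D then v (\<lambda>x. u x i) else 0)"

definition smooth_embedding ::
    "'a topology \<Rightarrow> nat \<Rightarrow> 'a chart set \<Rightarrow> nat \<Rightarrow> ('a \<Rightarrow> nat \<Rightarrow> real) \<Rightarrow> bool" where
  "smooth_embedding X n A D u \<longleftrightarrow>
     embedding_map X (Euclidean_space D) u \<and>
     (\<forall>i<D. smooth_fun n A (\<lambda>x. u x i)) \<and>
     (\<forall>p\<in>topspace X. inj_on (differential D u) (tangent_space X n A p))"

definition pullback_metric ::
    "nat \<Rightarrow> ('a \<Rightarrow> nat \<Rightarrow> real) \<Rightarrow> 'a tangent \<Rightarrow> 'a tangent \<Rightarrow> real" where
  "pullback_metric D u v w = (\<Sum>i<D. differential D u v i * differential D u w i)"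

definition isometric_embedding ::
    "'a topology \<Rightarrow> nat \<Rightarrow> 'a chart set \<Rightarrow> ('a \<Rightarrow> 'a tangent \<Rightarrow> 'a tangent \<Rightarrow> real) \<Rightarrow>
     nat \<Rightarrow> ('a \<Rightarrow> nat \<Rightarrow> real) \<Rightarrow> bool" where
  "isometric_embedding X n A g D u \<longleftrightarrow>
     smooth_embedding X n A D u \<and>
     (\<forall>p\<in>topspace X. \<forall>v\<in>tangent_space X n A p. \<forall>w\<in>tangent_space X n A p.
        pullback_metric D u v w = g p v w)"

definition all_metrics_embed :: "'a topology \<Rightarrow> nat \<Rightarrow> 'a chart set \<Rightarrow> nat \<Rightarrow> bool" where
  "all_metrics_embed X n A D \<longleftrightarrow>
     (\<forall>h. riemannian_metric X n A h \<longrightarrow> (\<exists>u. isometric_embedding X n A h D u))"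

text \<open>
  A relation rather than a function: that some \<open>D\<close> satisfies
  \<^const>\<open>all_metrics_embed\<close> is the Nash embedding theorem.
\<close>

definition is_nash_dimension :: "'a topology \<Rightarrow> nat \<Rightarrow> 'a chart set \<Rightarrow> nat \<Rightarrow> bool" where
  "is_nash_dimension X n A N \<longleftrightarrow>
     all_metrics_embed X n A N \<and> (\<forall>D. all_metrics_embed X n A D \<longrightarrow> N \<le> D)"

definition euclidean_bounded :: "nat \<Rightarrow> (nat \<Rightarrow> real) set \<Rightarrow> bool" where
  "euclidean_bounded D S \<longleftrightarrow> (\<exists>B. \<forall>y\<in>S. L2_set y {..<D} \<le> B)"

end

theory Submission
  imports Defs
begin

text \<open>
  A curve \<open>\<gamma> : \<real> \<rightarrow> \<real>\<^sup>2\<close> of unit speed that is an embedding with bounded image gives the isometric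
  embedding \<open>\<gamma> \<times> \<dots> \<times> \<gamma>\<close> of \<open>\<real>\<^sup>N\<close> in \<open>\<real>\<^sup>2\<^sup>N\<close> with bounded image, and it remains to compose it with an
  isometric embedding of the manifold in \<open>\<real>\<^sup>N\<close>. For \<open>\<gamma>\<close> we take a spiral whose distance
  \<open>r(t) = 1 + 2 arctan(e\<^sup>t)\<close> from the origin increases from \<open>1\<close> to \<open>1 + \<pi>\<close>. Since \<open>r' = sech\<close>,
  the speed is \<open>1\<close> if the polar angle \<open>\<theta>\<close> satisfies \<open>r \<theta>' = tanh\<close>. A chain rule for
  derivations, which follows from Hadamard's lemma in one variable, transfers this to the
  tangent spaces of the manifold.
\<close>

section \<open>Smooth functions on the real line\<close>

text \<open>The greatest fixed point is infinite differentiability; the least one would be empty. A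
  class of functions consists of smooth ones as soon as each member has a derivative within the
  class, by coinduction.\<close>

coinductive smooth_real :: "(real \<Rightarrow> real) \<Rightarrow> bool" where
  "(\<And>x. (f has_real_derivative f' x) (at x)) \<Longrightarrow> smooth_real f' \<Longrightarrow> smooth_real f"

lemma smooth_real_derivE:
  assumes "smooth_real f"
  obtains f' where "\<And>x. (f has_real_derivative f' x) (at x)" "smooth_real f'"
  using assms
proof cases
  case (1 f')
  then show thesis by (rule that)
qed

lemma smooth_real_continuous_on:
  assumes "smooth_real f"
  shows "continuous_on S f"
proof -
  obtain f' where "\<And>x. (f has_real_derivative f' x) (at x)"
    using assms by (blast elim: smooth_real_derivE)
  then show ?thesis
    by (intro DERIV_continuous_on) (auto intro: has_field_derivative_at_within)
qed

text \<open>Differentiation under the integral sign: the inner chain rule yields a factor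
  \<open>t\<close>, so \<open>k\<close> rises by one. The weight \<open>t ^ k\<close> is there to
  close this family of integrals under differentiation.\<close>

lemma has_real_derivative_integral_moment:
  fixes f f' :: "real \<Rightarrow> real"
  assumes f: "\<And>x. (f has_real_derivative f' x) (at x)" and f': "continuous_on UNIV f'"
  shows "((\<lambda>y. integral {0..1} (\<lambda>t. t ^ k * f (a + t * (y - a)))) has_real_derivative
          integral {0..1} (\<lambda>t. t ^ Suc k * f' (a + t * (x - a)))) (at x)"
proof -
  have cont: "continuous_on UNIV f"
    using f by (intro DERIV_continuous_on) (auto intro: has_field_derivative_at_within)
  have "((\<lambda>y. integral (cbox 0 1) (\<lambda>t. t ^ k * f (a + t * (y - a)))) has_field_derivative
          integral (cbox 0 1) (\<lambda>t. t ^ Suc k * f' (a + t * (x - a)))) (at x within UNIV)"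
  proof (rule leibniz_rule_field_derivative)
    fix y t :: real
    show "((\<lambda>y. t ^ k * f (a + t * (y - a))) has_real_derivative
            t ^ Suc k * f' (a + t * (y - a))) (at y within UNIV)"
      by (auto intro!: derivative_eq_intros DERIV_chain2[OF f] simp: mult_ac)
  next
    fix y :: real
    show "(\<lambda>t. t ^ k * f (a + t * (y - a))) integrable_on cbox 0 1"
      by (intro integrable_continuous continuous_intros continuous_on_compose2[OF cont]) auto
  next
    show "continuous_on (UNIV \<times> cbox 0 1) (\<lambda>(y, t). t ^ Suc k * f' (a + t * (y - a)))"
      unfolding case_prod_unfold
      by (intro continuous_intros continuous_on_compose2[OF f']) auto
  qed auto
  then show ?thesis by simp
qed

lemma smooth_real_integral_moment:
  assumes "smooth_real f"
  shows "smooth_real (\<lambda>y. integral {0..1} (\<lambda>t. t ^ k * f (a + t * (y - a))))"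
proof -
  \<comment> \<open>The coinduction invariant quantifies over \<open>k\<close> and \<open>f\<close>,
    because differentiating changes both.\<close>
  have "smooth_real h" if "\<exists>k f. smooth_real f \<and>
    h = (\<lambda>y. integral {0..1} (\<lambda>t. t ^ k * f (a + t * (y - a))))" for h
    using that
  proof (coinduction arbitrary: h)
    case smooth_real
    then obtain k f where f: "smooth_real f"
      and h: "h = (\<lambda>y. integral {0..1} (\<lambda>t. t ^ k * f (a + t * (y - a))))"
      by blast
    obtain f' where f': "\<And>x. (f has_real_derivative f' x) (at x)" "smooth_real f'"
      using f by (blast elim: smooth_real_derivE)
    let ?h' = "\<lambda>x. integral {0..1} (\<lambda>t. t ^ Suc k * f' (a + t * (x - a)))"
    have "\<forall>x. (h has_real_derivative ?h' x) (at x)"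
      using has_real_derivative_integral_moment[OF f'(1) smooth_real_continuous_on[OF f'(2)]]
      unfolding h by blast
    moreover have "\<exists>k f. smooth_real f \<and>
        ?h' = (\<lambda>y. integral {0..1} (\<lambda>t. t ^ k * f (a + t * (y - a))))"
      using f'(2) by blast
    ultimately show ?case
      by - (rule exI[of _ h], rule exI[of _ ?h'], blast)
  qed
  then show ?thesis using assms by blast
qed

text \<open>Integrating the derivative of \<open>f\<close> along the segment from \<open>a\<close>
  to \<open>y\<close> and pulling out the factor \<open>y - a\<close> leaves the zeroth moment of
  \<open>f'\<close>, which is smooth in \<open>y\<close>. This drives the chain rule for
  derivations.\<close>

lemma Hadamard_lemma:
  assumes f: "smooth_real f" and Df: "(f has_real_derivative D) (at a)"
  obtains h where "smooth_real h" "h a = D" "\<And>y. f y = f a + (y - a) * h y"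
proof -
  obtain f' where f': "\<And>x. (f has_real_derivative f' x) (at x)" "smooth_real f'"
    using f by (blast elim: smooth_real_derivE)
  define h where "h = (\<lambda>y. integral {0..1} (\<lambda>t. t ^ 0 * f' (a + t * (y - a))))"
  have "smooth_real h"
    unfolding h_def by (rule smooth_real_integral_moment[OF f'(2)])
  moreover have "h a = D"
    using DERIV_unique[OF Df f'(1)] by (simp add: h_def)
  moreover have "f y = f a + (y - a) * h y" for y
  proof -
    have "((\<lambda>t. (y - a) * f' (a + t * (y - a))) has_integral
        f (a + 1 * (y - a)) - f (a + 0 * (y - a))) {0..1}"
    proof (rule fundamental_theorem_of_calculus)
      fix t :: real
      have "((\<lambda>t. f (a + t * (y - a))) has_real_derivative f' (a + t * (y - a)) * (y - a))
          (at t within {0..1})"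
        by (rule DERIV_chain2[OF f'(1)]) (auto intro!: derivative_eq_intros)
      then have "((\<lambda>t. f (a + t * (y - a))) has_real_derivative (y - a) * f' (a + t * (y - a)))
          (at t within {0..1})"
        by (simp only: mult.commute)
      then show "((\<lambda>t. f (a + t * (y - a))) has_vector_derivative
          (y - a) * f' (a + t * (y - a))) (at t within {0..1})"
        by (rule has_real_derivative_iff_has_vector_derivative[THEN iffD1])
    qed auto
    from integral_unique[OF this] show ?thesis by (simp add: h_def)
  qed
  ultimately show ?thesis using that by blast
qed

section \<open>The unit speed spiral\<close>

text \<open>Up to an additive constant this is the Gudermannian function. Since 1 - sech^2 = tanh^2
  is the square of a smooth function, the angular speed can be chosen smooth.\<close>

definition spiral_radius :: "real \<Rightarrow> real" where
  "spiral_radius t = 1 + 2 * arctan (exp t)"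

lemma spiral_radius_bounds: "1 < spiral_radius t" "spiral_radius t < 1 + pi"
  using arctan_ubound[of "exp t"] by (auto simp: spiral_radius_def)

lemma DERIV_spiral_radius: "(spiral_radius has_real_derivative 1 / cosh t) (at t)"
proof -
  have "2 * e / (1 + e\<^sup>2) = 1 / ((e + inverse e) / 2)" if "e > 0" for e :: real
    using that by (simp add: divide_simps power2_eq_square)
  from this[of "exp t"] have "2 * exp t / (1 + (exp t)\<^sup>2) = 1 / cosh t"
    by (simp add: cosh_field_def exp_minus)
  moreover have "(spiral_radius has_real_derivative 2 * exp t / (1 + (exp t)\<^sup>2)) (at t)"
    unfolding spiral_radius_def[abs_def]
    by (rule derivative_eq_intros refl | simp add: divide_inverse)+
  ultimately show ?thesis by simp
qed

lemma spiral_angle_exists: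
  "\<exists>\<theta>. \<forall>t. (\<theta> has_real_derivative tanh t / spiral_radius t) (at t)"
proof -
  have "isCont (\<lambda>t. tanh t / spiral_radius t) t" for t
    using DERIV_isCont[OF DERIV_spiral_radius] spiral_radius_bounds(1)[of t]
    by (intro continuous_intros) auto
  then show ?thesis
    using einterval_antiderivative[of "-\<infinity>" "\<infinity>" "\<lambda>t. tanh t / spiral_radius t"]
    by (auto simp: has_real_derivative_iff_has_vector_derivative)
qed

text \<open>Only the derivative of the angle is ever used, so any antiderivative will do; another
  choice rotates the spiral.\<close>

definition spiral_angle :: "real \<Rightarrow> real" where
  "spiral_angle = (SOME \<theta>. \<forall>t. (\<theta> has_real_derivative tanh t / spiral_radius t) (at t))"

lemma DERIV_spiral_angle:
  "(spiral_angle has_real_derivative tanh t / spiral_radius t) (at t)"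
  using someI_ex[OF spiral_angle_exists] unfolding spiral_angle_def by blast

definition spiral_x :: "real \<Rightarrow> real" where
  "spiral_x t = spiral_radius t * cos (spiral_angle t)"

definition spiral_y :: "real \<Rightarrow> real" where
  "spiral_y t = spiral_radius t * sin (spiral_angle t)"

text \<open>The product rule for \<open>spiral_x\<close>, with the radius cancelled against the
  denominator of the angular speed.\<close>

definition spiral_dx :: "real \<Rightarrow> real" where
  "spiral_dx t = cos (spiral_angle t) / cosh t - tanh t * sin (spiral_angle t)"

definition spiral_dy :: "real \<Rightarrow> real" where
  "spiral_dy t = sin (spiral_angle t) / cosh t + tanh t * cos (spiral_angle t)"

lemma DERIV_spiral_x: "(spiral_x has_real_derivative spiral_dx t) (at t)"
  unfolding spiral_x_def spiral_dx_def using spiral_radius_bounds(1)[of t]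
  by (auto intro!: derivative_eq_intros DERIV_spiral_radius DERIV_spiral_angle simp: field_simps)

lemma DERIV_spiral_y: "(spiral_y has_real_derivative spiral_dy t) (at t)"
  unfolding spiral_y_def spiral_dy_def using spiral_radius_bounds(1)[of t]
  by (auto intro!: derivative_eq_intros DERIV_spiral_radius DERIV_spiral_angle simp: field_simps)

text \<open>The velocity is the vector (sech t, tanh t) rotated by the polar angle, and sech^2 +
  tanh^2 = 1.\<close>

lemma spiral_unit_speed: "(spiral_dx t)\<^sup>2 + (spiral_dy t)\<^sup>2 = 1"
proof -
  have "(c * S - T * s)\<^sup>2 + (s * S + T * c)\<^sup>2 = (S\<^sup>2 + T\<^sup>2) * (c\<^sup>2 + s\<^sup>2)" for c s S T :: real
    by (simp add: power2_eq_square algebra_simps)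
  from this[of "cos (spiral_angle t)" "1 / cosh t" "tanh t" "sin (spiral_angle t)"]
  have "(spiral_dx t)\<^sup>2 + (spiral_dy t)\<^sup>2 = (1 / cosh t)\<^sup>2 + (tanh t)\<^sup>2"
    by (simp add: spiral_dx_def spiral_dy_def)
  also have "\<dots> = (1 + (sinh t)\<^sup>2) / (cosh t)\<^sup>2"
    by (simp add: tanh_def power_divide add_divide_distrib)
  also have "1 + (sinh t)\<^sup>2 = (cosh t)\<^sup>2"
    by (simp add: cosh_square_eq)
  also have "(cosh t)\<^sup>2 / (cosh t)\<^sup>2 = 1"
    using cosh_real_pos[of t] by simp
  finally show ?thesis .
qed

text \<open>The generators are chosen so that the algebra is closed under differentiation.\<close>

inductive_set spiral_algebra :: "(real \<Rightarrow> real) set" where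
  const: "(\<lambda>t. c) \<in> spiral_algebra"
| sech: "(\<lambda>t. 1 / cosh t) \<in> spiral_algebra"
| tanh: "tanh \<in> spiral_algebra"
| radius: "spiral_radius \<in> spiral_algebra"
| inverse_radius: "(\<lambda>t. 1 / spiral_radius t) \<in> spiral_algebra"
| cos_angle: "(\<lambda>t. cos (spiral_angle t)) \<in> spiral_algebra"
| sin_angle: "(\<lambda>t. sin (spiral_angle t)) \<in> spiral_algebra"
| add: "f \<in> spiral_algebra \<Longrightarrow> h \<in> spiral_algebra \<Longrightarrow> (\<lambda>t. f t + h t) \<in> spiral_algebra"
| mult: "f \<in> spiral_algebra \<Longrightarrow> h \<in> spiral_algebra \<Longrightarrow> (\<lambda>t. f t * h t) \<in> spiral_algebra"

lemma spiral_algebra_deriv: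
  assumes "f \<in> spiral_algebra"
  shows "\<exists>f'\<in>spiral_algebra. \<forall>t. (f has_real_derivative f' t) (at t)"
  using assms
proof induction
  case (const c)
  then show ?case by (auto intro!: bexI[of _ "\<lambda>t. 0"] spiral_algebra.intros)
next
  case sech
  \<comment> \<open>Here and below the derivative is spelled as sums and products of generators,
    with the constant \<open>-1\<close> for signs, so that the introduction rules apply
    literally.\<close>
  have mem: "(\<lambda>t. (-1) * ((1 / cosh t) * tanh t)) \<in> spiral_algebra"
    by (intro spiral_algebra.intros)
  have deriv: "((\<lambda>t. 1 / cosh t) has_real_derivative (-1) * ((1 / cosh t) * tanh t)) (at t)"
    for t :: real
    using cosh_real_pos[of t]
    by (auto intro!: derivative_eq_intros simp: tanh_def field_simps)
  show ?case by (intro bexI[OF _ mem] allI deriv)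
next
  case tanh
  have mem: "(\<lambda>t. 1 + (-1) * (tanh t * tanh t)) \<in> spiral_algebra"
    by (intro spiral_algebra.intros)
  have deriv: "(tanh has_real_derivative 1 + (-1) * (tanh t * tanh t)) (at t)" for t :: real
    by (auto intro!: derivative_eq_intros simp: power2_eq_square)
  show ?case by (intro bexI[OF _ mem] allI deriv)
next
  case radius
  show ?case by (intro bexI[OF _ spiral_algebra.sech] allI DERIV_spiral_radius)
next
  case inverse_radius
  have mem: "(\<lambda>t. (-1) * ((1 / cosh t) * ((1 / spiral_radius t) * (1 / spiral_radius t)))) \<in> spiral_algebra"
    by (intro spiral_algebra.intros)
  have deriv: "((\<lambda>t. 1 / spiral_radius t) has_real_derivative
      (-1) * ((1 / cosh t) * ((1 / spiral_radius t) * (1 / spiral_radius t)))) (at t)" for t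
    using spiral_radius_bounds(1)[of t]
    by (auto intro!: derivative_eq_intros DERIV_spiral_radius simp: field_simps)
  show ?case by (intro bexI[OF _ mem] allI deriv)
next
  case cos_angle
  have mem: "(\<lambda>t. (-1) * (sin (spiral_angle t) * (tanh t * (1 / spiral_radius t)))) \<in> spiral_algebra"
    by (intro spiral_algebra.intros)
  have deriv: "((\<lambda>t. cos (spiral_angle t)) has_real_derivative
      (-1) * (sin (spiral_angle t) * (tanh t * (1 / spiral_radius t)))) (at t)" for t
    by (auto intro!: derivative_eq_intros DERIV_spiral_angle)
  show ?case by (intro bexI[OF _ mem] allI deriv)
next
  case sin_angle
  have mem: "(\<lambda>t. cos (spiral_angle t) * (tanh t * (1 / spiral_radius t))) \<in> spiral_algebra"
    by (intro spiral_algebra.intros)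
  have deriv: "((\<lambda>t. sin (spiral_angle t)) has_real_derivative
      cos (spiral_angle t) * (tanh t * (1 / spiral_radius t))) (at t)" for t
    by (auto intro!: derivative_eq_intros DERIV_spiral_angle)
  show ?case by (intro bexI[OF _ mem] allI deriv)
next
  case (add f h)
  then obtain f' h' where *: "f' \<in> spiral_algebra" "h' \<in> spiral_algebra"
    "\<And>t. (f has_real_derivative f' t) (at t)" "\<And>t. (h has_real_derivative h' t) (at t)"
    by blast
  then have mem: "(\<lambda>t. f' t + h' t) \<in> spiral_algebra"
    by (intro spiral_algebra.intros)
  have deriv: "((\<lambda>t. f t + h t) has_real_derivative f' t + h' t) (at t)" for t
    by (intro derivative_intros *)
  show ?case by (intro bexI[OF _ mem] allI deriv)
next
  case (mult f h)
  then obtain f' h' where *: "f' \<in> spiral_algebra" "h' \<in> spiral_algebra"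
    "\<And>t. (f has_real_derivative f' t) (at t)" "\<And>t. (h has_real_derivative h' t) (at t)"
    by blast
  then have mem: "(\<lambda>t. f' t * h t + h' t * f t) \<in> spiral_algebra"
    using mult by (intro spiral_algebra.intros)
  have deriv: "((\<lambda>t. f t * h t) has_real_derivative f' t * h t + h' t * f t) (at t)" for t
    by (intro DERIV_mult *)
  show ?case by (intro bexI[OF _ mem] allI deriv)
qed

lemma smooth_real_spiral_algebra:
  assumes "f \<in> spiral_algebra"
  shows "smooth_real f"
  using assms
proof (coinduction arbitrary: f)
  case smooth_real
  then show ?case using spiral_algebra_deriv by blast
qed

lemma smooth_real_spiral_x: "smooth_real spiral_x"
  and smooth_real_spiral_y: "smooth_real spiral_y"
  unfolding spiral_x_def[abs_def] spiral_y_def[abs_def]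
  by (intro smooth_real_spiral_algebra spiral_algebra.intros)+

section \<open>Boundedness of the spiral and recovery of the parameter from the radius\<close>

lemma norm_spiral: "sqrt ((spiral_x t)\<^sup>2 + (spiral_y t)\<^sup>2) = spiral_radius t"
proof -
  have "(spiral_x t)\<^sup>2 + (spiral_y t)\<^sup>2 = (spiral_radius t)\<^sup>2"
    unfolding spiral_x_def spiral_y_def
    by (simp add: power_mult_distrib flip: distrib_left)
  then show ?thesis using spiral_radius_bounds(1)[of t] by simp
qed

lemma spiral_abs_le: "\<bar>spiral_x t\<bar> \<le> 1 + pi" "\<bar>spiral_y t\<bar> \<le> 1 + pi"
  using real_sqrt_sum_squares_ge1[of "spiral_x t" "spiral_y t"]
    real_sqrt_sum_squares_ge1[of "- spiral_x t" "spiral_y t"]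
    real_sqrt_sum_squares_ge2[of "spiral_y t" "spiral_x t"]
    real_sqrt_sum_squares_ge2[of "- spiral_y t" "spiral_x t"]
    spiral_radius_bounds(2)[of t]
  by (auto simp: norm_spiral abs_le_iff)

definition spiral_inverse :: "real \<Rightarrow> real" where
  "spiral_inverse \<rho> = ln (tan ((\<rho> - 1) / 2))"

lemma spiral_inverse_radius: "spiral_inverse (spiral_radius t) = t"
  by (simp add: spiral_inverse_def spiral_radius_def tan_arctan)

text \<open>On this interval, which contains all radii, the argument of \<open>tan\<close> lies
  strictly between 0 and pi/2, so that \<open>cos\<close> and \<open>tan\<close> are positive there.
  The parameter is thus a continuous function of the radius, and the spiral is an embedding.\<close>

lemma continuous_on_spiral_inverse: "continuous_on {1<..<1 + pi} spiral_inverse"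
proof -
  have "cos ((\<rho> - 1) / 2) \<noteq> 0" "tan ((\<rho> - 1) / 2) \<noteq> 0" if "\<rho> \<in> {1<..<1 + pi}" for \<rho>
    using that cos_gt_zero[of "(\<rho> - 1) / 2"] tan_gt_zero[of "(\<rho> - 1) / 2"] by auto
  then show ?thesis
    unfolding spiral_inverse_def by (intro continuous_intros) auto
qed

section \<open>The product of spirals\<close>

text \<open>Coordinates \<open>2 * i\<close> and \<open>2 * i + 1\<close> hold the spiral point with
  parameter \<open>y i\<close>; the zeros beyond them keep the values in
  \<open>Euclidean_space (2 * N)\<close>.\<close>

definition spiral_map :: "nat \<Rightarrow> (nat \<Rightarrow> real) \<Rightarrow> nat \<Rightarrow> real" where
  "spiral_map N y = (\<lambda>k. if k < 2 * N then
     (if even k then spiral_x (y (k div 2)) else spiral_y (y (k div 2))) else 0)"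

lemma continuous_map_Euclidean_space_coord:
  "continuous_map (Euclidean_space n) euclideanreal (\<lambda>x. x i)"
  unfolding Euclidean_space_def
  by (intro continuous_map_from_subtopology continuous_map_product_projection) auto

lemma continuous_map_compose_real:
  assumes "continuous_on T h" "continuous_map X euclideanreal f" "f ` topspace X \<subseteq> T"
  shows "continuous_map X euclideanreal (\<lambda>x. h (f x))"
proof -
  have "continuous_map (top_of_set T) euclideanreal h"
    using assms(1) by simp
  moreover have "continuous_map X (top_of_set T) f"
    using assms(2,3) by (auto simp: continuous_map_in_subtopology)
  ultimately show ?thesis
    using continuous_map_compose[of X "top_of_set T" f euclideanreal h] by (simp add: o_def)
qed

text \<open>A continuous left inverse \<open>L\<close> on the image is explicit: the norm of the
  \<open>i\<close>-th pair of coordinates is the radius at \<open>y i\<close>, and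
  \<open>spiral_inverse\<close> turns it back into \<open>y i\<close>.\<close>

lemma embedding_map_spiral_map:
  "embedding_map (Euclidean_space N) (Euclidean_space (2 * N)) (spiral_map N)"
proof -
  let ?E = "Euclidean_space N" and ?F = "Euclidean_space (2 * N)"
  let ?S = "spiral_map N ` topspace ?E"
  define \<rho> where "\<rho> = (\<lambda>(z :: nat \<Rightarrow> real) i. sqrt ((z (2 * i))\<^sup>2 + (z (2 * i + 1))\<^sup>2))"
  define L where "L = (\<lambda>z i. if i < N then spiral_inverse (\<rho> z i) else 0)"
  have \<rho>: "\<rho> (spiral_map N y) i = spiral_radius (y i)" if "i < N" for y i
    using that norm_spiral[of "y i"] by (simp add: \<rho>_def spiral_map_def)
  \<comment> \<open>From index \<open>N\<close> on the default value 0 is correct, as points of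
    \<open>Euclidean_space N\<close> vanish there.\<close>
  have L: "L (spiral_map N y) = y" if "y \<in> topspace ?E" for y
    using that by (auto simp: L_def \<rho> spiral_inverse_radius topspace_Euclidean_space)
  have "continuous_map ?E ?F (spiral_map N)"
    unfolding spiral_map_def continuous_map_componentwise_Euclidean_space
  proof (intro allI impI)
    fix k
    show "continuous_map ?E euclideanreal
      (\<lambda>y. if even k then spiral_x (y (k div 2)) else spiral_y (y (k div 2)))"
      using continuous_map_compose_real[OF smooth_real_continuous_on[OF smooth_real_spiral_x]
          continuous_map_Euclidean_space_coord subset_UNIV]
        continuous_map_compose_real[OF smooth_real_continuous_on[OF smooth_real_spiral_y]
          continuous_map_Euclidean_space_coord subset_UNIV]
      by (cases "even k") simp_all
  qed
  then have 1: "continuous_map ?E (subtopology ?F ?S) (spiral_map N)"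
    by (auto simp: continuous_map_in_subtopology)
  have "continuous_map (subtopology ?F ?S) ?E L"
    unfolding L_def continuous_map_componentwise_Euclidean_space
  proof (intro allI impI)
    fix i assume i: "i < N"
    have "continuous_map (subtopology ?F ?S) euclideanreal (\<lambda>z. (z (2 * i))\<^sup>2 + (z (2 * i + 1))\<^sup>2)"
      by (intro continuous_map_add continuous_map_real_pow continuous_map_from_subtopology
          continuous_map_Euclidean_space_coord)
    then have "continuous_map (subtopology ?F ?S) euclideanreal (\<lambda>z. \<rho> z i)"
      unfolding \<rho>_def
      using continuous_map_compose_real[OF continuous_on_real_sqrt[OF continuous_on_id]] by blast
    then show "continuous_map (subtopology ?F ?S) euclideanreal (\<lambda>z. spiral_inverse (\<rho> z i))"
      using spiral_radius_bounds i
      by (intro continuous_map_compose_real[OF continuous_on_spiral_inverse]) (auto simp: \<rho>)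
  qed
  with 1 have "homeomorphic_maps ?E (subtopology ?F ?S) (spiral_map N) L"
    using L by (auto simp: homeomorphic_maps_def)
  then show ?thesis
    unfolding embedding_map_def using homeomorphic_map_maps by blast
qed

text \<open>A crude bound by the sum of absolute values is enough; what matters is its independence
  of \<open>y\<close>.\<close>

lemma spiral_map_bounded: "L2_set (spiral_map N y) {..<2 * N} \<le> 2 * N * (1 + pi)"
proof -
  have "L2_set (spiral_map N y) {..<2 * N} \<le> (\<Sum>k<2 * N. \<bar>spiral_map N y k\<bar>)"
    by (rule L2_set_le_sum_abs)
  also have "\<dots> \<le> (\<Sum>k<2 * N. 1 + pi)"
    by (intro sum_mono) (auto simp: spiral_map_def spiral_abs_le)
  finally show ?thesis by simp
qed

section \<open>Smooth functions on open sets of Euclidean space\<close>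

lemma Ck_on_continuous_map:
  "Ck_on n k S f \<Longrightarrow> continuous_map (subtopology (Euclidean_space n) S) euclideanreal f"
  by (cases k) auto

lemma Ck_on_SucD:
  assumes "Ck_on n (Suc k) S f" "i < n"
  shows "x \<in> S \<Longrightarrow> ((\<lambda>t. f (x(i := t))) has_real_derivative partial i f x) (at (x i))"
    and "Ck_on n k S (partial i f)"
  using assms by (auto simp: partial_def field_differentiable_derivI)

text \<open>This makes a partial derivative at a point of \<open>S\<close> depend only on the values
  of the function on \<open>S\<close>.\<close>

lemma eventually_fun_upd_in_open:
  assumes S: "openin (Euclidean_space n) S" and "x \<in> S" "i < n"
  shows "eventually (\<lambda>t. x(i := t) \<in> S) (nhds (x i))"
proof -
  have x: "\<forall>j\<ge>n. x j = 0"
    using openin_subset[OF S] \<open>x \<in> S\<close> by (auto simp: topspace_Euclidean_space)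
  \<comment> \<open>The line is rewritten in the form that the componentwise continuity criterion
    expects; the two forms agree because \<open>x\<close> vanishes from index \<open>n\<close> on
    and \<open>i < n\<close>.\<close>
  have "continuous_map euclideanreal (Euclidean_space n)
      (\<lambda>t j. if j < n then (if j = i then t else x j) else 0)"
    unfolding continuous_map_componentwise_Euclidean_space by auto
  moreover have "(\<lambda>t j. if j < n then (if j = i then t else x j) else 0) = (\<lambda>t. x(i := t))"
    using x \<open>i < n\<close> by (auto simp: fun_eq_iff)
  ultimately have "continuous_map euclideanreal (Euclidean_space n) (\<lambda>t. x(i := t))"
    by simp
  from openin_continuous_map_preimage[OF this S] have "open {t. x(i := t) \<in> S}"
    by simp
  then show ?thesis
    using \<open>x \<in> S\<close> eventually_nhds_in_open[of "{t. x(i := t) \<in> S}" "x i"] by simp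
qed

lemma has_real_derivative_slice_cong:
  assumes "openin (Euclidean_space n) S" "x \<in> S" "i < n" "\<And>x. x \<in> S \<Longrightarrow> f x = h x"
  shows "((\<lambda>t. f (x(i := t))) has_real_derivative D) (at (x i)) \<longleftrightarrow>
         ((\<lambda>t. h (x(i := t))) has_real_derivative D) (at (x i))"
  using eventually_fun_upd_in_open[OF assms(1-3)] assms(4)
  by (intro DERIV_cong_ev) (auto elim: eventually_mono)

text \<open>Partial derivatives of functions that agree on the open set \<open>S\<close> agree on
  \<open>S\<close>, but perhaps not elsewhere, so the induction must generalize over both
  functions.\<close>

lemma Ck_on_cong:
  assumes S: "openin (Euclidean_space n) S" and "\<And>x. x \<in> S \<Longrightarrow> f x = h x" and "Ck_on n k S f"
  shows "Ck_on n k S h"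
  using assms(2,3)
proof (induction k arbitrary: f h)
  case 0
  then show ?case by (auto elim!: continuous_map_eq)
next
  case (Suc k)
  have deriv: "((\<lambda>t. h (x(i := t))) has_real_derivative partial i f x) (at (x i))"
    if "x \<in> S" "i < n" for x i
    using has_real_derivative_slice_cong[OF S that, of f h, OF Suc.prems(1)]
      Ck_on_SucD(1)[OF Suc.prems(2) that(2,1)] by blast
  have "partial i f x = partial i h x" if "x \<in> S" "i < n" for x i
    using DERIV_imp_deriv[OF deriv[OF that]] by (simp add: partial_def[of i h])
  then have "Ck_on n k S (partial i h)" if "i < n" for i
    using Suc.IH[of "partial i f" "partial i h"] Ck_on_SucD(2)[OF Suc.prems(2) that] that by blast
  moreover have "continuous_map (subtopology (Euclidean_space n) S) euclideanreal h"
    using Ck_on_continuous_map[OF Suc.prems(2)] Suc.prems(1) by (auto elim!: continuous_map_eq)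
  ultimately show ?case
    using deriv by (auto simp: field_differentiable_def)
qed

text \<open>Replaces \<open>partial i f\<close>, whose values off \<open>S\<close> are uncontrolled,
  by any explicit formula that is valid on \<open>S\<close>.\<close>

lemma Ck_on_SucI:
  assumes S: "openin (Euclidean_space n) S"
    and "continuous_map (subtopology (Euclidean_space n) S) euclideanreal f"
    and deriv: "\<And>i x. i < n \<Longrightarrow> x \<in> S \<Longrightarrow>
      ((\<lambda>t. f (x(i := t))) has_real_derivative f' i x) (at (x i))"
    and f': "\<And>i. i < n \<Longrightarrow> Ck_on n k S (f' i)"
  shows "Ck_on n (Suc k) S f"
proof -
  have "Ck_on n k S (partial i f)" if "i < n" for i
    using Ck_on_cong[OF S _ f'[OF that]] DERIV_imp_deriv[OF deriv[OF that]]
    by (simp add: partial_def)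
  then show ?thesis
    using assms(2) deriv by (auto simp: field_differentiable_def)
qed

lemma Ck_on_SucD_le: "Ck_on n (Suc k) S f \<Longrightarrow> Ck_on n k S f"
  by (induction k arbitrary: f) auto

lemma Ck_on_const:
  assumes "openin (Euclidean_space n) S"
  shows "Ck_on n k S (\<lambda>x. c)"
proof (induction k arbitrary: c)
  case (Suc k)
  show ?case
    by (rule Ck_on_SucI[OF assms, where f' = "\<lambda>i x. 0"]) (auto simp: Suc)
qed auto

lemma Ck_on_add:
  assumes S: "openin (Euclidean_space n) S" and "Ck_on n k S f" "Ck_on n k S h"
  shows "Ck_on n k S (\<lambda>x. f x + h x)"
  using assms(2,3)
proof (induction k arbitrary: f h)
  case 0
  then show ?case by (auto intro: continuous_map_add)
next
  case (Suc k)
  show ?case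
  proof (rule Ck_on_SucI[OF S, where f' = "\<lambda>i x. partial i f x + partial i h x"])
    show "continuous_map (subtopology (Euclidean_space n) S) euclideanreal (\<lambda>x. f x + h x)"
      by (intro continuous_map_add Ck_on_continuous_map[OF Suc.prems(1)]
          Ck_on_continuous_map[OF Suc.prems(2)])
  qed (intro derivative_intros Suc.IH Ck_on_SucD[OF Suc.prems(1)] Ck_on_SucD[OF Suc.prems(2)];
      assumption)+
qed

lemma Ck_on_mult:
  assumes S: "openin (Euclidean_space n) S" and "Ck_on n k S f" "Ck_on n k S h"
  shows "Ck_on n k S (\<lambda>x. f x * h x)"
  using assms(2,3)
proof (induction k arbitrary: f h)
  case 0
  then show ?case by (auto intro: continuous_map_real_mult)
next
  case (Suc k)
  show ?case
  \<comment> \<open>The factors \<open>f\<close> and \<open>h\<close> recur in the derivative, so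
    they are needed at the lower order too; \<open>Ck_on_SucD_le\<close> supplies this.\<close>
  proof (rule Ck_on_SucI[OF S, where f' = "\<lambda>i x. partial i f x * h x + partial i h x * f x"])
    show "continuous_map (subtopology (Euclidean_space n) S) euclideanreal (\<lambda>x. f x * h x)"
      by (intro continuous_map_real_mult Ck_on_continuous_map[OF Suc.prems(1)]
          Ck_on_continuous_map[OF Suc.prems(2)])
  next
    fix i x assume "i < n" "x \<in> S"
    from DERIV_mult[OF Ck_on_SucD(1)[OF Suc.prems(1) this] Ck_on_SucD(1)[OF Suc.prems(2) this]]
    show "((\<lambda>t. f (x(i := t)) * h (x(i := t))) has_real_derivative
        partial i f x * h x + partial i h x * f x) (at (x i))"
      by (simp only: fun_upd_triv)
  qed (intro Ck_on_add[OF S] Suc.IH Ck_on_SucD(2)[OF Suc.prems(1)] Ck_on_SucD(2)[OF Suc.prems(2)]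
      Ck_on_SucD_le[OF Suc.prems(1)] Ck_on_SucD_le[OF Suc.prems(2)]; assumption)
qed

lemma Ck_on_smooth_real_compose:
  assumes S: "openin (Euclidean_space n) S" and "smooth_real h" "Ck_on n k S f"
  shows "Ck_on n k S (\<lambda>x. h (f x))"
  using assms(2,3)
\<comment> \<open>The outer function must vary: the chain rule replaces \<open>h\<close> by
  \<open>h'\<close>, to which the induction hypothesis is applied.\<close>
proof (induction k arbitrary: h f)
  case 0
  then show ?case
    using continuous_map_compose_real[OF smooth_real_continuous_on[of h UNIV]] by simp
next
  case (Suc k)
  obtain h' where h': "\<And>x. (h has_real_derivative h' x) (at x)" "smooth_real h'"
    using Suc.prems(1) by (blast elim: smooth_real_derivE)
  show ?case
  proof (rule Ck_on_SucI[OF S, where f' = "\<lambda>i x. h' (f x) * partial i f x"])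
    show "continuous_map (subtopology (Euclidean_space n) S) euclideanreal (\<lambda>x. h (f x))"
      using continuous_map_compose_real[OF smooth_real_continuous_on[OF Suc.prems(1)]
          Ck_on_continuous_map[OF Suc.prems(2)] subset_UNIV] .
  next
    fix i x assume "i < n" "x \<in> S"
    from DERIV_chain2[OF h'(1) Ck_on_SucD(1)[OF Suc.prems(2) this]]
    show "((\<lambda>t. h (f (x(i := t)))) has_real_derivative h' (f x) * partial i f x) (at (x i))"
      by (simp only: fun_upd_triv)
  next
    fix i assume "i < n"
    then show "Ck_on n k S (\<lambda>x. h' (f x) * partial i f x)"
      using Ck_on_mult[OF S Suc.IH[OF h'(2) Ck_on_SucD_le[OF Suc.prems(2)]]
          Ck_on_SucD(2)[OF Suc.prems(2)]] by blast
  qed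
qed

section \<open>Closure properties of smooth functions on the manifold\<close>

lemma smooth_fun_const:
  assumes "\<forall>c\<in>A. chart_on X n c"
  shows "smooth_fun n A (\<lambda>x. c)"
  using assms by (auto simp: smooth_fun_def smooth_on_def chart_on_def intro!: Ck_on_const)

lemma smooth_fun_smooth_real_compose:
  assumes "\<forall>c\<in>A. chart_on X n c" "smooth_real h" "smooth_fun n A f"
  shows "smooth_fun n A (\<lambda>x. h (f x))"
  using assms(1,3)
  by (auto simp: smooth_fun_def smooth_on_def chart_on_def
      intro!: Ck_on_smooth_real_compose[OF _ assms(2)])

lemma smooth_fun_add:
  assumes "\<forall>c\<in>A. chart_on X n c" "smooth_fun n A f" "smooth_fun n A h"
  shows "smooth_fun n A (\<lambda>x. f x + h x)"
  using assms by (auto simp: smooth_fun_def smooth_on_def chart_on_def intro!: Ck_on_add)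

lemma smooth_fun_mult:
  assumes "\<forall>c\<in>A. chart_on X n c" "smooth_fun n A f" "smooth_fun n A h"
  shows "smooth_fun n A (\<lambda>x. f x * h x)"
  using assms by (auto simp: smooth_fun_def smooth_on_def chart_on_def intro!: Ck_on_mult)

section \<open>Tangent vectors and the isometric embedding\<close>

lemma tangent_space_add:
  "v \<in> tangent_space X n A p \<Longrightarrow> smooth_fun n A f \<Longrightarrow> smooth_fun n A h \<Longrightarrow>
   v (\<lambda>x. f x + h x) = v f + v h"
  unfolding tangent_space_def by blast

lemma tangent_space_mult:
  "v \<in> tangent_space X n A p \<Longrightarrow> smooth_fun n A f \<Longrightarrow> smooth_fun n A h \<Longrightarrow>
   v (\<lambda>x. f x * h x) = f p * v h + h p * v f"
  unfolding tangent_space_def by blast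

lemma tangent_space_scale:
  "v \<in> tangent_space X n A p \<Longrightarrow> smooth_fun n A f \<Longrightarrow> v (\<lambda>x. c * f x) = c * v f"
  unfolding tangent_space_def by blast

lemma tangent_space_const:
  assumes "\<forall>c\<in>A. chart_on X n c" "v \<in> tangent_space X n A p"
  shows "v (\<lambda>x. c) = 0"
proof -
  have 1: "smooth_fun n A (\<lambda>x. 1)"
    using smooth_fun_const[OF assms(1)] .
  \<comment> \<open>The Leibniz rule for 1 = 1 * 1 makes this value equal to its own double.\<close>
  then have "v (\<lambda>x. 1) = 0"
    using tangent_space_mult[OF assms(2) 1 1] by simp
  then show ?thesis
    using tangent_space_scale[OF assms(2) 1, of c] by simp
qed

text \<open>Hadamard's lemma at \<open>f p\<close> writes h(f) as a constant plus (f - f(p)) q(f)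
  with q(f(p)) = D. In the Leibniz rule at \<open>p\<close> the term with the factor f - f(p)
  vanishes, which leaves \<open>D * v f\<close>. All functions involved are global, so no cut-off
  functions enter.\<close>

lemma tangent_space_chain_rule:
  assumes A: "\<forall>c\<in>A. chart_on X n c" and v: "v \<in> tangent_space X n A p"
    and h: "smooth_real h" "(h has_real_derivative D) (at (f p))" and f: "smooth_fun n A f"
  shows "v (\<lambda>x. h (f x)) = D * v f"
proof -
  obtain q where q: "smooth_real q" "q (f p) = D"
    and hq: "\<And>y. h y = h (f p) + (y - f p) * q y"
    using Hadamard_lemma[OF h] by blast
  have s1: "smooth_fun n A (\<lambda>x. c)" for c
    using smooth_fun_const[OF A] .
  \<comment> \<open>The difference is written as a sum so that the additivity rules match
    it.\<close>
  have s2: "smooth_fun n A (\<lambda>x. f x + (- f p))"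
    by (intro smooth_fun_add[OF A] f s1)
  have s3: "smooth_fun n A (\<lambda>x. q (f x))"
    using smooth_fun_smooth_real_compose[OF A q(1) f] .
  have "v (\<lambda>x. h (f x)) = v (\<lambda>x. h (f p) + (f x + (- f p)) * q (f x))"
    by (subst hq) simp
  also have "\<dots> = v (\<lambda>x. (f x + (- f p)) * q (f x))"
    using tangent_space_add[OF v s1 smooth_fun_mult[OF A s2 s3]] tangent_space_const[OF A v]
    by simp
  also have "\<dots> = D * v (\<lambda>x. f x + (- f p))"
    using tangent_space_mult[OF v s2 s3] q(2) by simp
  also have "v (\<lambda>x. f x + (- f p)) = v f"
    using tangent_space_add[OF v f s1] tangent_space_const[OF A v] by (simp only: add_0_right)
  finally show ?thesis .
qed

lemma sum_double_lessThan:
  fixes f :: "nat \<Rightarrow> 'b::comm_monoid_add"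
  shows "(\<Sum>k<2 * N. f k) = (\<Sum>i<N. f (2 * i) + f (2 * i + 1))"
  by (induction N) (auto simp: add_ac)

text \<open>By the chain rule, the two coordinates built from \<open>u x i\<close> contribute to the
  pullback the squared speed of the spiral, which is 1, times the contribution of
  \<open>u x i\<close> alone.\<close>

lemma isometric_embedding_spiral_map:
  assumes A: "\<forall>c\<in>A. chart_on X n c" and u: "isometric_embedding X n A g N u"
  shows "isometric_embedding X n A g (2 * N) (\<lambda>x. spiral_map N (u x))"
proof -
  let ?w = "\<lambda>x. spiral_map N (u x)"
  have smooth_u: "smooth_fun n A (\<lambda>x. u x i)" if "i < N" for i
    using u that by (auto simp: isometric_embedding_def smooth_embedding_def)
  have emb: "embedding_map X (Euclidean_space (2 * N)) ?w"
    using embedding_map_compose[OF _ embedding_map_spiral_map, of X N u] u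
    by (simp add: isometric_embedding_def smooth_embedding_def o_def)
  have smooth_w: "smooth_fun n A (\<lambda>x. ?w x k)" if "k < 2 * N" for k
  proof -
    have "k div 2 < N" using that by auto
    then show ?thesis
      using that smooth_fun_smooth_real_compose[OF A smooth_real_spiral_x smooth_u]
        smooth_fun_smooth_real_compose[OF A smooth_real_spiral_y smooth_u]
      by (cases "even k") (simp_all add: spiral_map_def)
  qed
  have dw: "differential (2 * N) ?w v (2 * i) = spiral_dx (u p i) * v (\<lambda>x. u x i)"
      "differential (2 * N) ?w v (2 * i + 1) = spiral_dy (u p i) * v (\<lambda>x. u x i)"
    if v: "v \<in> tangent_space X n A p" and "i < N" for v p i
    using tangent_space_chain_rule[OF A v smooth_real_spiral_x DERIV_spiral_x smooth_u]
      tangent_space_chain_rule[OF A v smooth_real_spiral_y DERIV_spiral_y smooth_u] \<open>i < N\<close>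
    by (simp_all add: differential_def spiral_map_def)
  have pullback: "pullback_metric (2 * N) ?w v v' = pullback_metric N u v v'"
    if v: "v \<in> tangent_space X n A p" and v': "v' \<in> tangent_space X n A p" for v v' p
  proof -
    have "pullback_metric (2 * N) ?w v v' =
        (\<Sum>i<N. ((spiral_dx (u p i))\<^sup>2 + (spiral_dy (u p i))\<^sup>2) *
          (v (\<lambda>x. u x i) * v' (\<lambda>x. u x i)))"
      unfolding pullback_metric_def sum_double_lessThan
      by (intro sum.cong refl)
        (simp only: lessThan_iff dw[OF v] dw[OF v'], simp add: power2_eq_square algebra_simps)
    then show ?thesis
      by (simp add: spiral_unit_speed pullback_metric_def differential_def)
  qed
  have "inj_on (differential (2 * N) ?w) (tangent_space X n A p)" if p: "p \<in> topspace X" for p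
  proof (rule inj_onI)
    fix v v'
    assume v: "v \<in> tangent_space X n A p" and v': "v' \<in> tangent_space X n A p"
      and eq: "differential (2 * N) ?w v = differential (2 * N) ?w v'"
    \<comment> \<open>By unit speed \<open>spiral_dx\<close> and \<open>spiral_dy\<close> do not
      both vanish, so one of the two equations can be divided by its factor.\<close>
    have "v (\<lambda>x. u x i) = v' (\<lambda>x. u x i)" if "i < N" for i
      using fun_cong[OF eq, of "2 * i"] fun_cong[OF eq, of "2 * i + 1"]
        spiral_unit_speed[of "u p i"]
      unfolding dw[OF v that] dw[OF v' that] by auto
    then have "differential N u v = differential N u v'"
      by (auto simp: differential_def)
    then show "v = v'"
      using u p v v' by (auto simp: isometric_embedding_def smooth_embedding_def dest: inj_onD)
  qed
  then show ?thesis
    using emb smooth_w pullback u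
    by (simp add: isometric_embedding_def smooth_embedding_def)
qed

theorem theorem2:
  fixes X :: "'a topology" and n N :: nat and A :: "'a chart set"
    and g :: "'a \<Rightarrow> 'a tangent \<Rightarrow> 'a tangent \<Rightarrow> real"
  assumes "smooth_manifold X n A"
    and "riemannian_metric X n A g"
    and "is_nash_dimension X n A N"
  shows "\<exists>u. isometric_embedding X n A g (2 * N) u \<and>
             euclidean_bounded (2 * N) (u ` topspace X)"
proof -
  obtain u where "isometric_embedding X n A g N u"
    using assms(2) assms(3)[unfolded is_nash_dimension_def all_metrics_embed_def, THEN conjunct1]
    by auto
  then have "isometric_embedding X n A g (2 * N) (\<lambda>x. spiral_map N (u x))"
    using assms(1) by (intro isometric_embedding_spiral_map) (auto simp: smooth_manifold_def)
  moreover have "euclidean_bounded (2 * N) ((\<lambda>x. spiral_map N (u x)) ` topspace X)"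
    unfolding euclidean_bounded_def using spiral_map_bounded by blast
  ultimately show ?thesis by blast
qed

end
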